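(* Let $d\ge 3$ be an integer, let $a_0,\dots,a_d\in\mathbb{C}$ with $a_0\neq 0$, and let $$f(x)=a_0x^d+\binom{d}{1}a_1x^{d-1}+\cdots+\binom{d}{d-1}a_{d-1}x+a_d.$$ Put $$D_1=\begin{vmatrix} a_0 & a_1 \\ a_1 & a_2 \end{vmatrix},\quad D_2=\begin{vmatrix} a_0 & a_2 \\ a_1 & a_3 \end{vmatrix},\quad D_3=\begin{vmatrix} a_1 & a_2 \\ a_2 & a_3 \end{vmatrix},\quad \lambda_{1,2}=\frac{D_2\pm\sqrt{D_2^2-4D_1D_3}}{2},$$ and let $\Pi$ be the $(d-1)\times 3$ Hankel matrix whose $i$-th row is $(a_{i-1},a_i,a_{i+1})$ for $i=1,\dots,d-1$. (1) If $\operatorname{rank}\Pi=2$, $D_1\neq 0$ and $D_2^2\neq 4D_1D_3$, then the roots of $f(x)=0$ are $$x_i=\frac{\delta\zeta^i\lambda_1-\lambda_2}{D_1(1-\delta\zeta^i)},\qquad i=0,1,\dots,d-1,$$ where $\delta$ is a $d$-th root of $\frac{\lambda_2a_0-D_1a_1}{\lambda_1a_0-D_1a_1}$ and $\zeta=\cos\frac{2\pi}{d}+i\sin\frac{2\pi}{d}$. (2) If $\operatorname{rank}\Pi=2$, $D_1\neq 0$ and $D_2^2=4D_1D_3$, then the roots of $f(x)=0$ (with multiplicity) are $$x_1=\cdots=x_{d-1}=-\frac{D_2}{2D_1},\qquad x_d=\frac{(d-1)D_2}{2D_1}-\frac{da_1}{a_0}.$$ *)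

theory Defs
  imports
    Complex_Main
    "HOL-Library.Multiset"
    "HOL-Computational_Algebra.Polynomial"
    "Jordan_Normal_Form.Determinant"
    "Jordan_Normal_Form.DL_Rank"
begin

text \<open>The coefficients \<open>a\<^sub>0, \<dots>, a\<^sub>d\<close> are given by a function on the
  natural numbers; its values beyond \<open>d\<close> are never used (for \<open>d \<ge> 3\<close>).\<close>

definition binom_poly :: "nat \<Rightarrow> (nat \<Rightarrow> complex) \<Rightarrow> complex poly" where
  "binom_poly d a = (\<Sum>k\<le>d. monom (of_nat (d choose k) * a k) (d - k))"

definition D1 :: "(nat \<Rightarrow> complex) \<Rightarrow> complex" where
  "D1 a = det (mat_of_rows_list 2 [[a 0, a 1], [a 1, a 2]])"

definition D2 :: "(nat \<Rightarrow> complex) \<Rightarrow> complex" where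
  "D2 a = det (mat_of_rows_list 2 [[a 0, a 2], [a 1, a 3]])"

definition D3 :: "(nat \<Rightarrow> complex) \<Rightarrow> complex" where
  "D3 a = det (mat_of_rows_list 2 [[a 1, a 2], [a 2, a 3]])"

text \<open>Rows and columns are counted from 0, so row \<open>i\<close> is \<open>(a\<^sub>i, a\<^sub>i\<^sub>+\<^sub>1, a\<^sub>i\<^sub>+\<^sub>2)\<close>
  for \<open>0 \<le> i \<le> d - 2\<close>.\<close>

definition hankel_mat :: "nat \<Rightarrow> (nat \<Rightarrow> complex) \<Rightarrow> complex mat" where
  "hankel_mat d a = mat (d - 1) 3 (\<lambda>(i, j). a (i + j))"

text \<open>The first argument of \<open>vec_space.rank\<close> is the number of rows.\<close>

definition hankel_rank :: "nat \<Rightarrow> (nat \<Rightarrow> complex) \<Rightarrow> nat" where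
  "hankel_rank d a = vec_space.rank (d - 1) (hankel_mat d a)"

definition root_of_unity :: "nat \<Rightarrow> complex" where
  "root_of_unity d =
     complex_of_real (cos (2 * pi / real d)) + \<i> * complex_of_real (sin (2 * pi / real d))"

end

theory Submission
  imports Defs
begin

text \<open>
  Since \<open>D\<^sub>1 \<noteq> 0\<close> and \<open>\<Pi>\<close> has a nontrivial kernel, the kernel is spanned by the cross product
  \<open>(D\<^sub>3, -D\<^sub>2, D\<^sub>1)\<close> of the first two rows. Hence the coefficients satisfy the linear recurrence
  \<open>D\<^sub>1 a\<^bsub>k+2\<^esub> = D\<^sub>2 a\<^bsub>k+1\<^esub> - D\<^sub>3 a\<^sub>k\<close>, whose characteristic roots are
  \<open>\<mu> = \<lambda>\<^sub>1 / D\<^sub>1\<close> and \<open>\<nu> = \<lambda>\<^sub>2 / D\<^sub>1\<close>. If \<open>\<mu> \<noteq> \<nu>\<close>, then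
  \<open>(\<mu> - \<nu>) a\<^sub>k = A \<mu>\<^sup>k + B \<nu>\<^sup>k\<close>, so \<open>(\<mu> - \<nu>) f(x) = A (x + \<mu>)\<^sup>d + B (x + \<nu>)\<^sup>d\<close> and
  \<open>AB = D\<^sub>1 \<noteq> 0\<close>; the roots are the solutions of \<open>x + \<nu> = w (x + \<mu>)\<close> with
  \<open>w\<^sup>d = -A / B\<close>. If \<open>\<mu> = \<nu>\<close>, the confluent solution of the recurrence gives a factor
  \<open>(x + \<mu>)\<^bsup>d-1\<^esup>\<close> of \<open>f\<close>.
\<close>

section \<open>Linear algebra: from the rank of the Hankel matrix to a recurrence\<close>

lemma det_2x2:
  fixes p q r s :: "'a :: comm_ring_1"
  shows "det (mat_of_rows_list 2 [[p, q], [r, s]]) = p * s - q * r"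
proof -
  have carrier: "mat_of_rows_list 2 [[p, q], [r, s]] \<in> carrier_mat 2 2"
    by (simp add: mat_of_rows_list_def numeral_2_eq_2)
  have perms: "{\<pi>. \<pi> permutes {0..<2::nat}} = {id, Transposition.transpose 0 1}"
  proof -
    have "{0..<2::nat} = {0, 1}" by auto
    thus ?thesis using permutes_doubleton_iff[of _ "0::nat" 1] by auto
  qed
  have "id \<noteq> Transposition.transpose (0::nat) 1"
    by (metis id_apply transpose_apply_first zero_neq_one)
  thus ?thesis
    unfolding det_def'[OF carrier] perms
    by (simp add: mat_of_rows_list_def sign_swap_id numeral_2_eq_2)
qed

text \<open>A linear dependency among the columns supplies the entries of \<open>v\<close>. Linear
  dependence concerns the set of columns and so does not see a repeated column; in that case the
  difference of two unit vectors is a kernel vector.\<close>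

lemma (in vec_space) rank_deficient_kernel_vector:
  assumes A: "A \<in> carrier_mat n nc" and "rank A \<noteq> nc"
  obtains v where "v \<in> carrier_vec nc" "v \<noteq> 0\<^sub>v nc" "A *\<^sub>v v = 0\<^sub>v n"
proof (cases "distinct (cols A)")
  case True
  with assms have "lin_dep (set (cols A))"
    using lin_indpt_full_rank by blast
  thus ?thesis using lin_depE[OF A _ True] that by blast
next
  case False
  then obtain i j where ij: "i < nc" "j < nc" "i \<noteq> j" "col A i = col A j"
    using A by (auto simp: distinct_conv_nth)
  define v :: "'a vec" where "v = unit_vec nc i - unit_vec nc j"
  have v: "v \<in> carrier_vec nc" by (simp add: v_def)
  have "v $ i \<noteq> 0\<^sub>v nc $ i" using ij by (simp add: v_def)
  hence "v \<noteq> 0\<^sub>v nc" by auto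
  moreover have "A *\<^sub>v v = 0\<^sub>v n"
  proof -
    have "A *\<^sub>v v = A *\<^sub>v unit_vec nc i - A *\<^sub>v unit_vec nc j"
      unfolding v_def by (rule mult_minus_distrib_mat_vec[OF A]) auto
    also have "\<dots> = col A i - col A j"
      using ij(1,2) A by (auto intro!: arg_cong2[where f = minus] eq_vecI)
    finally show ?thesis using ij A by auto
  qed
  ultimately show ?thesis using v that by blast
qed

lemma hankel_recurrence:
  assumes "hankel_rank d a \<noteq> 3" "D1 a \<noteq> 0" "3 \<le> d" "k + 2 \<le> d"
  shows "D1 a * a (k + 2) = D2 a * a (k + 1) - D3 a * a k"
proof -
  have H: "hankel_mat d a \<in> carrier_mat (d - 1) 3" by (simp add: hankel_mat_def)
  obtain v where v: "v \<in> carrier_vec 3" "v \<noteq> 0\<^sub>v 3" "hankel_mat d a *\<^sub>v v = 0\<^sub>v (d - 1)"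
    using vec_space.rank_deficient_kernel_vector[OF H] assms(1)
    unfolding hankel_rank_def by blast
  have eq: "a i * v $ 0 + a (i + 1) * v $ 1 + a (i + 2) * v $ 2 = 0" if "i + 2 \<le> d" for i
  proof -
    have i: "i < d - 1" using that by linarith
    have "(hankel_mat d a *\<^sub>v v) $ i = 0" using v(3) i by simp
    moreover have "{0..<3::nat} = {0, 1, 2}" by auto
    ultimately show ?thesis
      using i v(1) by (simp add: hankel_mat_def scalar_prod_def add_ac)
  qed
  define x y z where "x = v $ 0" and "y = v $ 1" and "z = v $ 2"
  note Ds = D1_def D2_def D3_def det_2x2
  have e0: "a 0 * x + a 1 * y + a 2 * z = 0"
    using eq[of 0] assms by (simp add: x_def y_def z_def eval_nat_numeral)
  have e1: "a 1 * x + a 2 * y + a 3 * z = 0"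
    using eq[of 1] assms by (simp add: x_def y_def z_def eval_nat_numeral)
  have ek: "a k * x + a (k + 1) * y + a (k + 2) * z = 0"
    using eq[of k] assms by (simp add: x_def y_def z_def)
  \<comment> \<open>Cramer elimination in rows 0 and 1: first \<open>y\<close>, then
    \<open>x\<close> is removed, which makes \<open>(x, y, z)\<close> proportional to
    \<open>(D3 a, - D2 a, D1 a)\<close>.\<close>
  have "D1 a * x - D3 a * z =
      a 2 * (a 0 * x + a 1 * y + a 2 * z) - a 1 * (a 1 * x + a 2 * y + a 3 * z)"
    unfolding Ds by (simp add: algebra_simps)
  hence xz: "D1 a * x = D3 a * z" unfolding e0 e1 by simp
  have "D1 a * y + D2 a * z =
      a 0 * (a 1 * x + a 2 * y + a 3 * z) - a 1 * (a 0 * x + a 1 * y + a 2 * z)"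
    unfolding Ds by (simp add: algebra_simps)
  hence yz: "D1 a * y = - D2 a * z" unfolding e0 e1 by (simp add: eq_neg_iff_add_eq_0)
  have "z \<noteq> 0"
  proof
    assume "z = 0"
    hence "x = 0" "y = 0" using xz yz assms by auto
    moreover have "i = 0 \<or> i = 1 \<or> i = 2" if "i < 3" for i :: nat using that by linarith
    ultimately have "v = 0\<^sub>v 3"
      using v(1) \<open>z = 0\<close> by (intro eq_vecI) (fastforce simp: x_def y_def z_def)+
    thus False using v by simp
  qed
  \<comment> \<open>Row \<open>k\<close> times \<open>D1 a\<close> becomes the recurrence times
    \<open>z\<close>, and \<open>z\<close> can be cancelled.\<close>
  have "a k * (D1 a * x) + a (k + 1) * (D1 a * y) + a (k + 2) * (D1 a * z) =
      D1 a * (a k * x + a (k + 1) * y + a (k + 2) * z)"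
    by (simp add: algebra_simps)
  hence "z * (D1 a * a (k + 2)) = z * (D2 a * a (k + 1) - D3 a * a k)"
    unfolding ek xz yz by (simp add: algebra_simps)
  thus ?thesis using \<open>z \<noteq> 0\<close> by simp
qed

text \<open>By Vieta, \<open>\<mu>\<close> and \<open>\<nu>\<close> are the roots of
  \<open>D1 a * t^2 - D2 a * t + D3 a\<close>. They may coincide, so the lemma serves both cases of
  the theorem.\<close>

lemma hankel_recurrence_char_roots:
  assumes "hankel_rank d a \<noteq> 3" "D1 a \<noteq> 0" "3 \<le> d" "k + 2 \<le> d"
    and "D1 a * (\<mu> + \<nu>) = D2 a" "D1 a * (\<mu> * \<nu>) = D3 a"
  shows "a (k + 2) = (\<mu> + \<nu>) * a (k + 1) - \<mu> * \<nu> * a k"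
proof -
  have "D1 a * a (k + 2) = D1 a * ((\<mu> + \<nu>) * a (k + 1) - \<mu> * \<nu> * a k)"
    using hankel_recurrence[OF assms(1-4)] unfolding assms(5,6)[symmetric]
    by (simp add: algebra_simps)
  thus ?thesis using assms(2) by simp
qed

section \<open>Closed forms for second-order linear recurrences\<close>

text \<open>The characteristic polynomial factors, so the sequence
  \<open>a (k + 1) - \<mu> * a k\<close> satisfies a first-order recurrence and is geometric with
  ratio \<open>\<nu>\<close>. This also holds for \<open>\<mu> = \<nu>\<close>.\<close>

lemma linear_recurrence_reduce_order:
  fixes a :: "nat \<Rightarrow> 'a :: comm_ring_1"
  assumes "\<And>k. k + 2 \<le> d \<Longrightarrow> a (k + 2) = (\<mu> + \<nu>) * a (k + 1) - \<mu> * \<nu> * a k"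
    and "k + 1 \<le> d"
  shows "a (k + 1) = \<mu> * a k + \<nu> ^ k * (a 1 - \<mu> * a 0)"
  using assms(2)
proof (induction k)
  case (Suc k)
  have "a (k + 1) = \<mu> * a k + \<nu> ^ k * (a 1 - \<mu> * a 0)"
    and "a (k + 2) = (\<mu> + \<nu>) * a (k + 1) - \<mu> * \<nu> * a k"
    using Suc assms(1)[of k] by simp_all
  hence "\<nu> * (a (k + 1) - \<mu> * a k) = \<nu> * (\<nu> ^ k * (a 1 - \<mu> * a 0))"
    and "a (k + 2) = \<mu> * a (k + 1) + \<nu> * (a (k + 1) - \<mu> * a k)"
    by (simp_all only:) (simp_all add: algebra_simps)
  thus ?case by (simp add: mult.assoc)
qed simp

lemma linear_recurrence_distinct:
  fixes a :: "nat \<Rightarrow> 'a :: field"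
  assumes rec: "\<And>k. k + 2 \<le> d \<Longrightarrow> a (k + 2) = (\<mu> + \<nu>) * a (k + 1) - \<mu> * \<nu> * a k"
    and "k \<le> d"
  shows "(\<mu> - \<nu>) * a k = (a 1 - \<nu> * a 0) * \<mu> ^ k + (\<mu> * a 0 - a 1) * \<nu> ^ k"
  using assms(2)
proof (induction k)
  case (Suc k)
  have step: "a (Suc k) = \<mu> * a k + \<nu> ^ k * (a 1 - \<mu> * a 0)"
    using linear_recurrence_reduce_order[OF rec, of d k] Suc.prems by simp
  have "(\<mu> - \<nu>) * a (Suc k) =
      \<mu> * ((\<mu> - \<nu>) * a k) + (\<mu> - \<nu>) * (\<nu> ^ k * (a 1 - \<mu> * a 0))"
    unfolding step by (simp add: algebra_simps)
  also have "(\<mu> - \<nu>) * a k = (a 1 - \<nu> * a 0) * \<mu> ^ k + (\<mu> * a 0 - a 1) * \<nu> ^ k"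
    using Suc by simp
  also have "\<mu> * \<dots> + (\<mu> - \<nu>) * (\<nu> ^ k * (a 1 - \<mu> * a 0)) =
      (a 1 - \<nu> * a 0) * (\<mu> * \<mu> ^ k) + (\<mu> * a 0 - a 1) * (\<nu> * \<nu> ^ k)"
    by (simp add: algebra_simps)
  finally show ?case by simp
qed (simp add: algebra_simps)

text \<open>The confluent solution. At \<open>k = 0\<close> the truncated exponent
  \<open>k - 1\<close> is harmless because of the factor \<open>of_nat k\<close>.\<close>

lemma linear_recurrence_double:
  fixes a :: "nat \<Rightarrow> 'a :: comm_ring_1"
  assumes rec: "\<And>k. k + 2 \<le> d \<Longrightarrow> a (k + 2) = (\<mu> + \<mu>) * a (k + 1) - \<mu> * \<mu> * a k"
    and "k \<le> d"
  shows "a k = a 0 * \<mu> ^ k + of_nat k * (a 1 - \<mu> * a 0) * \<mu> ^ (k - 1)"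
  using assms(2)
proof (induction k)
  case (Suc k)
  have "a (Suc k) = \<mu> * a k + \<mu> ^ k * (a 1 - \<mu> * a 0)"
    using linear_recurrence_reduce_order[OF rec, of d k] Suc.prems by simp
  also have "a k = a 0 * \<mu> ^ k + of_nat k * (a 1 - \<mu> * a 0) * \<mu> ^ (k - 1)"
    using Suc by simp
  finally show ?case by (cases k) (simp_all add: algebra_simps)
qed simp

section \<open>Binomial sums and the polynomial with given coefficient sequence\<close>

lemma poly_binom_poly:
  "poly (binom_poly d a) x = (\<Sum>k\<le>d. of_nat (d choose k) * a k * x ^ (d - k))"
  by (simp add: binom_poly_def poly_sum poly_monom)

lemma degree_binom_poly_le: "degree (binom_poly d a) \<le> d"
  unfolding binom_poly_def
  by (intro degree_sum_le) (auto intro: order_trans[OF degree_monom_le])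

lemma binom_poly_nonzero:
  assumes "a 0 \<noteq> 0"
  shows "binom_poly d a \<noteq> 0"
proof -
  have "coeff (binom_poly d a) d = (\<Sum>k\<le>d. if k = 0 then a 0 else 0)"
    unfolding binom_poly_def coeff_sum by (intro sum.cong) auto
  also have "\<dots> = a 0" by simp
  finally show ?thesis using assms by auto
qed

lemma sum_binomial_geometric:
  fixes x \<mu> :: "'a :: comm_ring_1"
  shows "(\<Sum>k\<le>d. of_nat (d choose k) * \<mu> ^ k * x ^ (d - k)) = (x + \<mu>) ^ d"
  by (subst add.commute) (simp add: binomial_ring)

text \<open>This is the formal derivative of the binomial theorem with respect to
  \<open>\<mu>\<close>; termwise it is the absorption identity for binomial coefficients.\<close>

lemma sum_binomial_geometric_deriv:
  fixes x \<mu> :: "'a :: comm_ring_1"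
  shows "(\<Sum>k\<le>d. of_nat (d choose k) * (of_nat k * \<mu> ^ (k - 1)) * x ^ (d - k)) =
    of_nat d * (x + \<mu>) ^ (d - 1)"
proof (cases d)
  case (Suc n)
  have shift: "of_nat (Suc n choose Suc k) * (of_nat (Suc k) * \<mu> ^ k) * x ^ (n - k) =
    of_nat (Suc n) * (of_nat (n choose k) * \<mu> ^ k * x ^ (n - k))" for k
  proof -
    have "of_nat (Suc n choose Suc k) * of_nat (Suc k) =
        (of_nat (Suc n) * of_nat (n choose k) :: 'a)"
      using binomial_absorption[of k "Suc n"]
      by (simp only: of_nat_mult[symmetric] mult.commute) simp
    thus ?thesis by (metis mult.assoc)
  qed
  have "(\<Sum>k\<le>Suc n. of_nat (Suc n choose k) * (of_nat k * \<mu> ^ (k - 1)) * x ^ (Suc n - k)) =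
      (\<Sum>k\<le>n. of_nat (Suc n choose Suc k) * (of_nat (Suc k) * \<mu> ^ k) * x ^ (n - k))"
    by (subst sum.atMost_Suc_shift) simp
  thus ?thesis
    unfolding Suc shift sum_distrib_left[symmetric] sum_binomial_geometric by simp
qed simp

text \<open>The polynomial depends linearly on its coefficient sequence, and a geometric sequence
  yields a pure power. The scalar \<open>c\<close> will be \<open>\<mu> - \<nu>\<close>.\<close>

lemma binom_poly_geometric:
  assumes "\<And>k. k \<le> d \<Longrightarrow> c * a k = A * \<mu> ^ k + B * \<nu> ^ k"
  shows "c * poly (binom_poly d a) x = A * (x + \<mu>) ^ d + B * (x + \<nu>) ^ d"
proof -
  have "c * poly (binom_poly d a) x = (\<Sum>k\<le>d. of_nat (d choose k) * (c * a k) * x ^ (d - k))"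
    by (simp add: poly_binom_poly sum_distrib_left mult_ac)
  also have "\<dots> = (\<Sum>k\<le>d. A * (of_nat (d choose k) * \<mu> ^ k * x ^ (d - k)) +
      B * (of_nat (d choose k) * \<nu> ^ k * x ^ (d - k)))"
    by (intro sum.cong refl) (simp add: assms algebra_simps)
  finally show ?thesis
    by (simp add: sum.distrib sum_distrib_left[symmetric] sum_binomial_geometric)
qed

text \<open>The two parts of the sequence yield \<open>A * (x + \<mu>) ^ d\<close> and
  \<open>d * B * (x + \<mu>) ^ (d - 1)\<close>, which share the factor
  \<open>(x + \<mu>) ^ (d - 1)\<close>. Equality of values at all complex points gives equality of
  polynomials.\<close>

lemma binom_poly_confluent:
  assumes "\<And>k. k \<le> d \<Longrightarrow> a k = A * \<mu> ^ k + of_nat k * B * \<mu> ^ (k - 1)"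
    and "0 < d"
  shows "binom_poly d a = [:\<mu>, 1:] ^ (d - 1) * [:A * \<mu> + of_nat d * B, A:]"
proof -
  have "poly (binom_poly d a) x =
      poly ([:\<mu>, 1:] ^ (d - 1) * [:A * \<mu> + of_nat d * B, A:]) x" for x
  proof -
    have "poly (binom_poly d a) x = (\<Sum>k\<le>d. A * (of_nat (d choose k) * \<mu> ^ k * x ^ (d - k)) +
        B * (of_nat (d choose k) * (of_nat k * \<mu> ^ (k - 1)) * x ^ (d - k)))"
      unfolding poly_binom_poly by (intro sum.cong refl) (simp add: assms(1) algebra_simps)
    also have "\<dots> = A * (x + \<mu>) ^ d + B * (of_nat d * (x + \<mu>) ^ (d - 1))"
      by (simp only: sum.distrib sum_distrib_left[symmetric] sum_binomial_geometric
          sum_binomial_geometric_deriv)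
    also have "(x + \<mu>) ^ d = (x + \<mu>) * (x + \<mu>) ^ (d - 1)"
      using \<open>0 < d\<close> by (metis power_eq_if not_gr_zero)
    finally show ?thesis by (simp add: poly_power algebra_simps)
  qed
  thus ?thesis by (simp add: poly_eq_poly_eq_iff[symmetric] fun_eq_iff)
qed

section \<open>Roots of unity and multisets of roots\<close>

lemma root_of_unity_power: "root_of_unity d ^ i = cis (2 * pi * real i / real d)"
proof -
  have "root_of_unity d = cis (2 * pi / real d)"
    by (simp add: root_of_unity_def complex_eq_iff)
  thus ?thesis by (simp add: DeMoivre mult_ac)
qed

lemma root_of_unity_power_eq_1: "0 < d \<Longrightarrow> (root_of_unity d ^ i) ^ d = 1"
  using DeMoivre[of "2 * pi * real i / real d" d] cis_multiple_2pi[of "real i"]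
  by (simp add: root_of_unity_power mult_ac)

lemma inj_on_root_of_unity_power: "inj_on (\<lambda>i. root_of_unity d ^ i) {0..<d}"
proof (cases "0 < d")
  case True
  thus ?thesis using bij_betw_imp_inj_on[OF bij_betw_roots_unity[OF True]]
    by (simp add: root_of_unity_power atLeast0LessThan)
qed simp

text \<open>As many distinct roots as the degree allows leave no room for further roots or for
  multiplicities above 1: a submultiset of at least the full size is the whole multiset.\<close>

lemma proots_eq_image_mset_roots:
  assumes "p \<noteq> 0" "degree p \<le> card I" "inj_on g I" "finite I"
    and "\<And>i. i \<in> I \<Longrightarrow> poly p (g i) = 0"
  shows "proots p = image_mset g (mset_set I)"
proof -
  have image: "image_mset g (mset_set I) = mset_set (g ` I)"
    using assms by (simp add: image_mset_mset_set)
  have "mset_set (g ` I) \<subseteq># mset_set (set_mset (proots p))"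
    using assms by (intro subset_imp_msubset_mset_set) (auto simp: poly_roots_finite)
  also have "\<dots> \<subseteq># proots p" by (rule mset_set_set_mset_msubset)
  finally have sub: "mset_set (g ` I) \<subseteq># proots p" .
  have "size (proots p) \<le> card I" using size_proots_le assms(2) order_trans by blast
  also have "card I = size (mset_set (g ` I))" using assms by (simp add: card_image)
  finally show ?thesis
    using sub mset_subset_size[of "mset_set (g ` I)" "proots p"] image
    by (metis leD subset_mset.le_neq_trans)
qed

text \<open>The value 1 would force \<open>- A / B = 1\<close>, that is \<open>A + B = 0\<close>.
  Excluding it keeps the denominators of the root formula nonzero.\<close>

lemma scaled_root_of_unity:
  assumes "0 < d" and \<delta>: "\<delta> ^ d = - A / B"
  shows "(\<delta> * root_of_unity d ^ i) ^ d = - A / B"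
    and "B \<noteq> 0 \<Longrightarrow> A + B \<noteq> 0 \<Longrightarrow> \<delta> * root_of_unity d ^ i \<noteq> 1"
proof -
  show power: "(\<delta> * root_of_unity d ^ i) ^ d = - A / B"
    using assms by (simp add: power_mult_distrib root_of_unity_power_eq_1)
  show "\<delta> * root_of_unity d ^ i \<noteq> 1" if "B \<noteq> 0" "A + B \<noteq> 0"
  proof
    assume "\<delta> * root_of_unity d ^ i = 1"
    hence "- A / B = 1" using power by simp
    hence "- A = B" using \<open>B \<noteq> 0\<close> by (metis divide_eq_1_iff)
    thus False using that by (metis add.right_inverse)
  qed
qed

text \<open>The Moebius map sending \<open>w\<close> to \<open>(w * \<mu> - \<nu>) / (1 - w)\<close>
  solves \<open>x + \<nu> = w * (x + \<mu>)\<close>. It carries the \<open>d\<close> distinct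
  solutions of \<open>w ^ d = - A / B\<close> to roots of \<open>p\<close>, injectively since
  \<open>\<mu> \<noteq> \<nu>\<close>.\<close>

lemma proots_sum_two_powers:
  fixes p :: "complex poly"
  assumes p: "p \<noteq> 0" "degree p \<le> d"
    and poly_p: "\<And>x. c * poly p x = A * (x + \<mu>) ^ d + B * (x + \<nu>) ^ d"
    and nonzero: "0 < d" "c \<noteq> 0" "A \<noteq> 0" "B \<noteq> 0" "A + B \<noteq> 0" "\<mu> \<noteq> \<nu>"
    and \<delta>: "\<delta> ^ d = - A / B"
  shows "proots p = image_mset
      (\<lambda>i. (\<delta> * root_of_unity d ^ i * \<mu> - \<nu>) / (1 - \<delta> * root_of_unity d ^ i))
      (mset_set {0..<d})"
proof -
  define w where "w = (\<lambda>i. \<delta> * root_of_unity d ^ i)"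
  have w_power: "w i ^ d = - A / B" and w: "w i \<noteq> 1" for i
    using scaled_root_of_unity[OF \<open>0 < d\<close> \<delta>] nonzero by (auto simp: w_def)
  \<comment> \<open>Here \<open>A \<noteq> 0\<close> enters: with \<open>\<delta> = 0\<close> all
    the \<open>w i\<close> would coincide.\<close>
  have "\<delta> ^ d \<noteq> 0" unfolding \<delta> using nonzero by simp
  hence "\<delta> \<noteq> 0" using \<open>0 < d\<close> by (metis power_0_left not_gr_zero)
  hence inj_w: "inj_on w {0..<d}"
    using inj_on_root_of_unity_power[of d] by (simp add: w_def inj_on_def)
  define g where "g = (\<lambda>i. (w i * \<mu> - \<nu>) / (1 - w i))"
  have "inj_on g {0..<d}"
  proof (rule inj_onI)
    fix i j assume ij: "i \<in> {0..<d}" "j \<in> {0..<d}" "g i = g j"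
    hence "(w i * \<mu> - \<nu>) * (1 - w j) = (w j * \<mu> - \<nu>) * (1 - w i)"
      using w[of i] w[of j] by (simp add: g_def frac_eq_eq)
    hence "(w i - w j) * (\<mu> - \<nu>) = 0" by (simp add: algebra_simps)
    hence "w i = w j" using nonzero by simp
    thus "i = j" using ij(1,2) by (rule inj_onD[OF inj_w])
  qed
  moreover have "poly p (g i) = 0" for i
  proof -
    have "g i * (1 - w i) = w i * \<mu> - \<nu>" using w[of i] by (simp add: g_def)
    hence "g i + \<nu> = w i * (g i + \<mu>)" by (simp add: algebra_simps)
    hence "c * poly p (g i) = A * (g i + \<mu>) ^ d + B * (w i ^ d * (g i + \<mu>) ^ d)"
      by (simp add: poly_p power_mult_distrib)
    also have "\<dots> = 0" using nonzero by (simp add: w_power)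
    finally show ?thesis using nonzero by simp
  qed
  ultimately have "proots p = image_mset g (mset_set {0..<d})"
    using p by (intro proots_eq_image_mset_roots) auto
  thus "proots p = image_mset
      (\<lambda>i. (\<delta> * root_of_unity d ^ i * \<mu> - \<nu>) / (1 - \<delta> * root_of_unity d ^ i))
      (mset_set {0..<d})"
    by (simp add: g_def w_def)
qed

text \<open>The variable \<open>s\<close> ranges over both square roots of the discriminant, which
  covers either sign choice. Part (1) also asserts that the denominators are nonzero, so no quotient
  takes the default value of division by 0. Equality of \<open>proots\<close> records
  multiplicities.\<close>

theorem theorem4p2:
  fixes d :: nat and a :: "nat \<Rightarrow> complex"
  assumes "d \<ge> 3" and "a 0 \<noteq> 0"
  shows
    "(hankel_rank d a = 2 \<and> D1 a \<noteq> 0 \<and> (D2 a)\<^sup>2 \<noteq> 4 * D1 a * D3 a \<longrightarrow>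
       (\<forall>s l1 l2 :: complex.
          s\<^sup>2 = (D2 a)\<^sup>2 - 4 * D1 a * D3 a \<and>
          l1 = (D2 a + s) / 2 \<and> l2 = (D2 a - s) / 2 \<longrightarrow>
          l1 * a 0 - D1 a * a 1 \<noteq> 0 \<and>
          (\<forall>\<delta> :: complex.
             \<delta> ^ d = (l2 * a 0 - D1 a * a 1) / (l1 * a 0 - D1 a * a 1) \<longrightarrow>
             (\<forall>i<d. D1 a * (1 - \<delta> * root_of_unity d ^ i) \<noteq> 0) \<and>
             proots (binom_poly d a) =
               image_mset
                 (\<lambda>i. (\<delta> * root_of_unity d ^ i * l1 - l2) /
                      (D1 a * (1 - \<delta> * root_of_unity d ^ i)))
                 (mset_set {0..<d}))))
     \<and>
     (hankel_rank d a = 2 \<and> D1 a \<noteq> 0 \<and> (D2 a)\<^sup>2 = 4 * D1 a * D3 a \<longrightarrow>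
       proots (binom_poly d a) =
         replicate_mset (d - 1) (- D2 a / (2 * D1 a)) +
         {# of_nat (d - 1) * D2 a / (2 * D1 a) - of_nat d * a 1 / a 0 #})"
proof (intro conjI[of "_ \<longrightarrow> _" "_ \<longrightarrow> _"] impI allI; (elim conjE)?)
  fix s l1 l2 :: complex
  assume rank: "hankel_rank d a = 2" and D1: "D1 a \<noteq> 0"
    and disc: "(D2 a)\<^sup>2 \<noteq> 4 * D1 a * D3 a"
    and s: "s\<^sup>2 = (D2 a)\<^sup>2 - 4 * D1 a * D3 a"
    and l1: "l1 = (D2 a + s) / 2" and l2: "l2 = (D2 a - s) / 2"
  define \<mu> \<nu> where "\<mu> = l1 / D1 a" and "\<nu> = l2 / D1 a"
  have l: "l1 = D1 a * \<mu>" "l2 = D1 a * \<nu>" using D1 by (simp_all add: \<mu>_def \<nu>_def)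
  have "s \<noteq> 0" using s disc by auto
  moreover have "D1 a * (\<mu> - \<nu>) = s"
    unfolding right_diff_distrib l[symmetric] by (simp add: l1 l2 field_simps)
  ultimately have "\<mu> \<noteq> \<nu>" by auto
  have sum: "D1 a * (\<mu> + \<nu>) = D2 a"
    unfolding distrib_left l[symmetric] by (simp add: l1 l2 field_simps)
  \<comment> \<open>The product of the characteristic roots comes from a difference of
    squares.\<close>
  have "4 * (l1 * l2) = (2 * l1) * (2 * l2)" by simp
  also have "2 * l1 = D2 a + s" by (simp add: l1)
  also have "2 * l2 = D2 a - s" by (simp add: l2)
  also have "(D2 a + s) * (D2 a - s) = (D2 a)\<^sup>2 - s\<^sup>2" by (simp add: power2_eq_square algebra_simps)
  finally have "l1 * l2 = D1 a * D3 a" by (simp add: s)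
  hence prod: "D1 a * (\<mu> * \<nu>) = D3 a" using D1 by (simp add: l mult_ac)
  have rec: "a (k + 2) = (\<mu> + \<nu>) * a (k + 1) - \<mu> * \<nu> * a k" if "k + 2 \<le> d" for k
    using rank D1 \<open>3 \<le> d\<close> that by (intro hankel_recurrence_char_roots[OF _ _ _ _ sum prod]) simp_all
  define A B where "A = a 1 - \<nu> * a 0" and "B = \<mu> * a 0 - a 1"
  have closed: "(\<mu> - \<nu>) * a k = A * \<mu> ^ k + B * \<nu> ^ k" if "k \<le> d" for k
    unfolding A_def B_def using linear_recurrence_distinct[OF rec that] .
  \<comment> \<open>Expanding \<open>A * B\<close> produces exactly this right-hand side times
    \<open>a 0\<close>, minus the square of \<open>a 1\<close>; hence \<open>A * B\<close> is the
    determinant \<open>D1 a\<close>.\<close>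
  have "a 2 = (\<mu> + \<nu>) * a 1 - \<mu> * \<nu> * a 0"
    using rec[of 0] \<open>3 \<le> d\<close> by (simp add: numeral_2_eq_2)
  hence "A * B = a 0 * a 2 - a 1 * a 1"
    by (simp only: A_def B_def) (simp add: algebra_simps)
  hence "A * B = D1 a" by (simp add: D1_def det_2x2)
  with D1 have AB: "A \<noteq> 0" "B \<noteq> 0" by auto
  \<comment> \<open>\<open>A + B\<close> is the leading coefficient of
    \<open>(\<mu> - \<nu>) f\<close>.\<close>
  have "A + B = (\<mu> - \<nu>) * a 0" by (simp add: A_def B_def algebra_simps)
  hence "A + B \<noteq> 0" using \<open>\<mu> \<noteq> \<nu>\<close> \<open>a 0 \<noteq> 0\<close> by simp
  have denom: "l1 * a 0 - D1 a * a 1 = D1 a * B" and numer: "l2 * a 0 - D1 a * a 1 = D1 a * (- A)"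
    by (simp_all add: l A_def B_def algebra_simps)
  show "l1 * a 0 - D1 a * a 1 \<noteq> 0 \<and>
      (\<forall>\<delta> :: complex.
         \<delta> ^ d = (l2 * a 0 - D1 a * a 1) / (l1 * a 0 - D1 a * a 1) \<longrightarrow>
         (\<forall>i<d. D1 a * (1 - \<delta> * root_of_unity d ^ i) \<noteq> 0) \<and>
         proots (binom_poly d a) =
           image_mset
             (\<lambda>i. (\<delta> * root_of_unity d ^ i * l1 - l2) /
                  (D1 a * (1 - \<delta> * root_of_unity d ^ i)))
             (mset_set {0..<d}))"
  proof (intro conjI allI impI)
    show "l1 * a 0 - D1 a * a 1 \<noteq> 0" unfolding denom using D1 AB by simp
  next
    fix \<delta> :: complex
    assume "\<delta> ^ d = (l2 * a 0 - D1 a * a 1) / (l1 * a 0 - D1 a * a 1)"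
    hence \<delta>: "\<delta> ^ d = - A / B" unfolding numer denom using D1 by simp
    have w: "\<delta> * root_of_unity d ^ i \<noteq> 1" for i
      using scaled_root_of_unity(2)[OF _ \<delta>] \<open>3 \<le> d\<close> AB \<open>A + B \<noteq> 0\<close> by simp
    show "D1 a * (1 - \<delta> * root_of_unity d ^ i) \<noteq> 0" for i
      using w[of i] D1 by simp
    have "proots (binom_poly d a) = image_mset
        (\<lambda>i. (\<delta> * root_of_unity d ^ i * \<mu> - \<nu>) / (1 - \<delta> * root_of_unity d ^ i))
        (mset_set {0..<d})"
      using \<open>3 \<le> d\<close> \<open>a 0 \<noteq> 0\<close> \<open>\<mu> \<noteq> \<nu>\<close> AB \<open>A + B \<noteq> 0\<close> \<delta>
      by (intro proots_sum_two_powers[OF _ _ binom_poly_geometric[OF closed]])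
        (auto simp: binom_poly_nonzero degree_binom_poly_le)
    also have "\<dots> = image_mset
        (\<lambda>i. (\<delta> * root_of_unity d ^ i * l1 - l2) / (D1 a * (1 - \<delta> * root_of_unity d ^ i)))
        (mset_set {0..<d})"
    proof -
      have "\<delta> * root_of_unity d ^ i * l1 - l2 = D1 a * (\<delta> * root_of_unity d ^ i * \<mu> - \<nu>)" for i
        by (simp add: l algebra_simps)
      thus ?thesis using D1 by simp
    qed
    finally show "proots (binom_poly d a) = image_mset
        (\<lambda>i. (\<delta> * root_of_unity d ^ i * l1 - l2) / (D1 a * (1 - \<delta> * root_of_unity d ^ i)))
        (mset_set {0..<d})" .
  qed
next
  assume rank: "hankel_rank d a = 2" and D1: "D1 a \<noteq> 0"
    and disc: "(D2 a)\<^sup>2 = 4 * D1 a * D3 a"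
  \<comment> \<open>The double characteristic root.\<close>
  define \<mu> where "\<mu> = D2 a / (2 * D1 a)"
  have sum: "D1 a * (\<mu> + \<mu>) = D2 a" using D1 by (simp add: \<mu>_def)
  have prod: "D1 a * (\<mu> * \<mu>) = D3 a"
    using D1 disc by (simp add: \<mu>_def field_simps power2_eq_square)
  have rec: "a (k + 2) = (\<mu> + \<mu>) * a (k + 1) - \<mu> * \<mu> * a k" if "k + 2 \<le> d" for k
    using rank D1 \<open>3 \<le> d\<close> that by (intro hankel_recurrence_char_roots[OF _ _ _ _ sum prod]) simp_all
  define B where "B = a 1 - \<mu> * a 0"
  have "binom_poly d a = [:\<mu>, 1:] ^ (d - 1) * [:a 0 * \<mu> + of_nat d * B, a 0:]"
  proof (rule binom_poly_confluent)
    show "a k = a 0 * \<mu> ^ k + of_nat k * B * \<mu> ^ (k - 1)" if "k \<le> d" for k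
      unfolding B_def by (rule linear_recurrence_double[OF rec that])
    show "0 < d" using \<open>3 \<le> d\<close> by simp
  qed
  \<comment> \<open>Making the linear factor monic exposes the remaining root.\<close>
  also have "[:a 0 * \<mu> + of_nat d * B, a 0:] = Polynomial.smult (a 0) [:\<mu> + of_nat d * B / a 0, 1:]"
    using \<open>a 0 \<noteq> 0\<close> by (simp add: field_simps)
  finally have "proots (binom_poly d a) =
      replicate_mset (d - 1) (- \<mu>) + {# - (\<mu> + of_nat d * B / a 0) #}"
    using \<open>a 0 \<noteq> 0\<close>
    by (simp add: proots_mult proots_power del: smult_pCons mult_smult_right)
  also have "- (\<mu> + of_nat d * B / a 0) = of_nat (d - 1) * \<mu> - of_nat d * a 1 / a 0"
    using \<open>3 \<le> d\<close> \<open>a 0 \<noteq> 0\<close> by (simp add: B_def of_nat_diff field_simps)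
  finally show "proots (binom_poly d a) =
      replicate_mset (d - 1) (- D2 a / (2 * D1 a)) +
      {# of_nat (d - 1) * D2 a / (2 * D1 a) - of_nat d * a 1 / a 0 #}"
    by (simp add: \<mu>_def)
qed

end
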